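(* Let $\mathcal S_2$ be a disk of radius $R_2>0$ in the ground plane, let a point (the aerial base station) be located at height $h>0$ above the center of $\mathcal S_2$, and let a device be uniformly distributed in $\mathcal S_2$. Then the 3-D Euclidean distance $Z_A$ between the aerial base station and the device has probability density function $$f_{Z_A}(z)=\frac{2z}{R_2^2},\qquad h\le z\le\sqrt{R_2^2+h^2}$$ (and $0$ elsewhere).
   Context: The ground plane is a plane in $\mathbb R^3$; height is measured perpendicularly to it. *)

theory Defs
  imports "HOL-Probability.Probability"
begin

definition planar_frame :: "(real^2 \<Rightarrow> real^3) \<Rightarrow> (real^3) set \<Rightarrow> bool"
  where "planar_frame \<phi> P \<longleftrightarrow> (\<forall>x y. dist (\<phi> x) (\<phi> y) = dist x y) \<and> range \<phi> = P"

(* Area on a plane P in space: planar Lebesgue measure transported along an isometry of R^2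
   onto P.  By plane_area_eq below the choice of the isometry is immaterial, and by
   planar_frame_exists there is one for every plane. *)
definition plane_area :: "(real^3) set \<Rightarrow> (real^3) measure"
  where "plane_area P = distr lborel borel (SOME \<phi>. planar_frame \<phi> P)"

lemma planar_frame_measurable:
  assumes "planar_frame \<phi> P"
  shows "\<phi> \<in> borel_measurable borel"
proof -
  have "1-lipschitz_on UNIV \<phi>"
    using assms by (intro lipschitz_onI) (auto simp: planar_frame_def)
  then show ?thesis
    using lipschitz_on_continuous_on borel_measurable_continuous_onI by blast
qed

lemma planar_frame_exists:
  assumes "affine P" "aff_dim P = 2"
  shows "\<exists>\<phi>. planar_frame \<phi> P"
proof -
  have ne: "P \<noteq> {}" using assms(2) by auto
  then obtain c where c: "c \<in> P" by blast
  let ?L = "(\<lambda>x. - c + x) ` P"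
  have sL: "subspace ?L"
    using affine_diffs_subspace[OF assms(1) c] by simp
  have "int (dim ?L) = aff_dim P"
    using aff_dim_eq_dim[of c P] c hull_inc[of c P affine] by simp
  then have d: "dim (UNIV :: (real^2) set) = dim ?L"
    using assms(2) by simp
  obtain f :: "real^2 \<Rightarrow> real^3" where f: "linear f" "f ` UNIV = ?L" "\<And>x. norm (f x) = norm x"
    using isometry_subspaces[OF subspace_UNIV sL d] by auto
  have "range (\<lambda>x. c + f x) = (\<lambda>x. c + x) ` ?L"
    using f(2) by (metis image_image)
  also have "\<dots> = P" by (auto simp: image_image)
  finally have "range (\<lambda>x. c + f x) = P" .
  moreover have "dist (c + f x) (c + f y) = dist x y" for x y
    using f(3)[of "x - y"] linear_diff[OF f(1)] by (simp add: dist_norm)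
  ultimately have "planar_frame (\<lambda>x. c + f x) P" unfolding planar_frame_def by blast
  then show ?thesis by blast
qed

lemma lborel_distr_orthogonal:
  fixes g :: "real^2 \<Rightarrow> real^2"
  assumes g: "orthogonal_transformation g"
  shows "distr lborel borel g = lborel"
proof -
  have lg: "linear g" using g by (rule orthogonal_transformation_linear)
  have bg: "bij g" using g by (rule orthogonal_transformation_bij)
  have mg: "g \<in> borel_measurable borel"
    using lg by (simp add: borel_measurable_continuous_onI linear_continuous_on linear_linear)
  have ig: "orthogonal_transformation (inv g)"
    using g by (rule orthogonal_transformation_inv)
  have "lborel = distr lborel borel g"
  proof (rule lborel_eqI)
    fix l u :: "real^2"
    assume le: "\<And>b. b \<in> Basis \<Longrightarrow> l \<bullet> b \<le> u \<bullet> b"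
    have v: "g -` box l u = inv g ` box l u"
      using bg by (simp add: bij_vimage_eq_inv_image)
    have m: "inv g ` box l u \<in> lmeasurable"
      by (rule measurable_orthogonal_image[OF ig]) simp
    have bm: "inv g ` box l u \<in> sets borel"
      using measurable_sets[OF mg, of "box l u"] v by simp
    have "emeasure (distr lborel borel g) (box l u) = emeasure lborel (inv g ` box l u)"
      using mg by (simp add: emeasure_distr v)
    also have "\<dots> = emeasure lebesgue (inv g ` box l u)"
      using bm by simp
    also have "\<dots> = ennreal (measure lebesgue (inv g ` box l u))"
      using m by (simp add: emeasure_eq_measure2)
    also have "\<dots> = ennreal (measure lebesgue (box l u))"
      using measure_orthogonal_image[OF ig, of "box l u"] by simp
    also have "\<dots> = (\<Prod>b\<in>Basis. (u - l) \<bullet> b)"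
      using le by (simp add: measure_lborel_box_eq)
    finally show "emeasure (distr lborel borel g) (box l u) = (\<Prod>b\<in>Basis. (u - l) \<bullet> b)" .
  qed simp
  then show ?thesis by simp
qed

lemma plane_area_eq:
  assumes \<phi>: "planar_frame \<phi> P"
  shows "plane_area P = distr lborel borel \<phi>"
proof -
  define \<psi> where "\<psi> = (SOME \<phi>. planar_frame \<phi> P)"
  have \<psi>: "planar_frame \<psi> P" unfolding \<psi>_def by (rule someI[of "\<lambda>\<phi>. planar_frame \<phi> P", OF \<phi>])
  define f where "f x = inv \<phi> (\<psi> x)" for x
  have f: "\<phi> (f x) = \<psi> x" for x
    using \<phi> \<psi> unfolding f_def planar_frame_def by (intro f_inv_into_f) auto
  have df: "dist (f x) (f y) = dist x y" for x y
    using \<phi> \<psi> f unfolding planar_frame_def by metis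
  define g where "g x = f x - f 0" for x
  have og: "orthogonal_transformation g"
    unfolding orthogonal_transformation_isometry g_def using df by (simp add: dist_norm)
  have mg: "g \<in> borel_measurable borel"
    using orthogonal_transformation_linear[OF og]
    by (simp add: borel_measurable_continuous_onI linear_continuous_on linear_linear)
  have mp: "\<phi> \<in> borel_measurable borel"
    using \<phi> by (rule planar_frame_measurable)
  have "plane_area P = distr lborel borel \<psi>"
    by (simp add: plane_area_def \<psi>_def)
  also have "\<psi> = \<phi> \<circ> ((\<lambda>x. f 0 + x) \<circ> g)"
    by (auto simp: fun_eq_iff g_def f)
  also have "distr lborel borel \<dots> =
      distr (distr (distr lborel borel g) borel (\<lambda>x. f 0 + x)) borel \<phi>"
    using mg mp by (simp add: distr_distr)
  also have "\<dots> = distr lborel borel \<phi>"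
    by (simp add: lborel_distr_orthogonal[OF og] lborel_distr_plus)
  finally show ?thesis .
qed

end

theory Submission
  imports Defs
begin

(* Relative to the foot c of the perpendicular, Pythagoras turns {dist B x \<le> a} into a disk about c
   of squared radius a^2 - h^2, so the distribution function of the distance is a ratio of areas
   of concentric disks, (a^2 - h^2) / R^2. *)

lemma emeasure_plane_area:
  assumes "planar_frame \<phi> P" "A \<in> sets borel"
  shows "emeasure (plane_area P) A = emeasure lborel (\<phi> -` A)"
  using assms planar_frame_measurable[OF assms(1)]
  by (simp add: plane_area_eq[OF assms(1)] emeasure_distr)

text \<open>A frame is an isometry onto \<open>P\<close>, so it pulls the disk back to a disk of the
  same radius in the coordinate plane, whose Lebesgue measure is known.\<close>

lemma emeasure_plane_area_disk:
  assumes P: "affine P" "aff_dim P = 2" and c: "c \<in> P" and r: "r \<ge> 0"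
  shows "emeasure (plane_area P) (P \<inter> cball c r) = ennreal (pi * r\<^sup>2)"
proof -
  obtain \<phi> where \<phi>: "planar_frame \<phi> P"
    using planar_frame_exists[OF P] by blast
  obtain c' where c': "\<phi> c' = c"
    using \<phi> c unfolding planar_frame_def by blast
  have "\<phi> -` (P \<inter> cball c r) = cball c' r"
  proof (rule set_eqI)
    fix x
    have "\<phi> x \<in> P" "dist c (\<phi> x) = dist c' x"
      using \<phi> c' unfolding planar_frame_def by auto
    then show "x \<in> \<phi> -` (P \<inter> cball c r) \<longleftrightarrow> x \<in> cball c' r" by simp
  qed
  moreover have "P \<inter> cball c r \<in> sets borel"
    using affine_closed[OF P(1)] by auto
  ultimately show ?thesis
    using r by (simp add: emeasure_plane_area[OF \<phi>] emeasure_cball unit_ball_vol_2)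
qed

text \<open>The segments from \<open>c\<close> to the raised point and from \<open>c\<close> to
  \<open>x\<close> are the legs of a right triangle; the distance in question is its
  hypotenuse.\<close>

lemma dist_above_plane:
  fixes c n x :: "'a::real_inner"
  assumes "norm n = 1" "n \<bullet> (x - c) = 0"
  shows "dist (c + h *\<^sub>R n) x = sqrt (h\<^sup>2 + (dist c x)\<^sup>2)"
proof -
  have "orthogonal (h *\<^sub>R n) (c - x)"
    using assms(2) by (simp add: orthogonal_def inner_diff_right)
  then have "(norm (h *\<^sub>R n + (c - x)))\<^sup>2 = (norm (h *\<^sub>R n))\<^sup>2 + (norm (c - x))\<^sup>2"
    by (rule norm_add_Pythagorean)
  moreover have "h *\<^sub>R n + (c - x) = c + h *\<^sub>R n - x" by simp
  ultimately have "(dist (c + h *\<^sub>R n) x)\<^sup>2 = h\<^sup>2 + (dist c x)\<^sup>2"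
    using assms(1) by (simp add: dist_norm)
  then show ?thesis by (metis real_sqrt_unique zero_le_dist)
qed

lemma emeasure_plane_area_dist_above:
  assumes P: "affine P" "aff_dim P = 2" and c: "c \<in> P"
    and n: "norm n = 1" "\<forall>x\<in>P. \<forall>y\<in>P. n \<bullet> (x - y) = 0"
    and R: "R > 0" and h: "0 < h" "h \<le> a"
  shows "emeasure (plane_area P) (P \<inter> cball c R \<inter> {x. dist (c + h *\<^sub>R n) x \<le> a}) =
    ennreal (pi * ((min a (sqrt (R\<^sup>2 + h\<^sup>2)))\<^sup>2 - h\<^sup>2))"
proof -
  \<comment> \<open>\<open>sqrt (R\<^sup>2 + h\<^sup>2)\<close> is the distance from the raised
    point to the rim of the disk. Capping \<open>a\<close> there merges the two constraints on
    \<open>x\<close> into one bound on its distance to that point.\<close>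
  define m where "m = min a (sqrt (R\<^sup>2 + h\<^sup>2))"
  have hm: "h \<le> m"
    using h unfolding m_def by (auto intro: real_le_rsqrt)
  then have nonneg: "0 \<le> m\<^sup>2 - h\<^sup>2" using h(1) by simp
  have "x \<in> cball c R \<inter> {x. dist (c + h *\<^sub>R n) x \<le> a} \<longleftrightarrow> x \<in> cball c (sqrt (m\<^sup>2 - h\<^sup>2))"
    if "x \<in> P" for x
  proof -
    have "dist c x \<le> R \<longleftrightarrow> sqrt (h\<^sup>2 + (dist c x)\<^sup>2) \<le> sqrt (R\<^sup>2 + h\<^sup>2)"
      using R by (simp add: add.commute)
    then have "x \<in> cball c R \<inter> {x. dist (c + h *\<^sub>R n) x \<le> a} \<longleftrightarrow> sqrt (h\<^sup>2 + (dist c x)\<^sup>2) \<le> m"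
      using dist_above_plane[OF n(1), of x c h] n(2) c that by (auto simp: m_def)
    \<comment> \<open>Squaring is an equivalence here because \<open>m\<close> is nonnegative, by
      \<open>hm\<close>.\<close>
    also have "\<dots> \<longleftrightarrow> h\<^sup>2 + (dist c x)\<^sup>2 \<le> m\<^sup>2"
      using hm h(1) by (intro real_sqrt_le_iff') auto
    also have "\<dots> \<longleftrightarrow> dist c x \<le> sqrt (m\<^sup>2 - h\<^sup>2)"
      using real_sqrt_le_iff[of "(dist c x)\<^sup>2" "m\<^sup>2 - h\<^sup>2"] by auto
    finally show ?thesis by simp
  qed
  then have "P \<inter> cball c R \<inter> {x. dist (c + h *\<^sub>R n) x \<le> a} = P \<inter> cball c (sqrt (m\<^sup>2 - h\<^sup>2))"
    by blast
  then show ?thesis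
    using emeasure_plane_area_disk[OF P c, of "sqrt (m\<^sup>2 - h\<^sup>2)"] nonneg by (simp add: m_def)
qed

text \<open>This is the distribution function of the claimed density: an antiderivative of
  \<open>2 * z / R\<^sup>2\<close> is \<open>z\<^sup>2 / R\<^sup>2\<close>, evaluated between
  \<open>h\<close> and \<open>min a s\<close>.\<close>

lemma nn_integral_linear_density:
  fixes h R s a :: real
  assumes "0 < h" "h \<le> s"
  shows "(\<integral>\<^sup>+z. ennreal ((if h \<le> z \<and> z \<le> s then 2 * z / R\<^sup>2 else 0) *
      indicator {..a} z) \<partial>lborel) = ennreal (if a < h then 0 else ((min a s)\<^sup>2 - h\<^sup>2) / R\<^sup>2)"
proof (cases "a < h")
  case True
  have "(\<integral>\<^sup>+z. ennreal ((if h \<le> z \<and> z \<le> s then 2 * z / R\<^sup>2 else 0) *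
      indicator {..a} z) \<partial>lborel) = (\<integral>\<^sup>+z. 0 \<partial>(lborel :: real measure))"
    by (intro nn_integral_cong) (use True in \<open>auto simp: indicator_def\<close>)
  with True show ?thesis by simp
next
  case False
  have deriv: "((\<lambda>z. z\<^sup>2 / R\<^sup>2) has_real_derivative 2 * z / R\<^sup>2) (at z within A)" for z A
    by (intro DERIV_cdivide) (auto intro!: derivative_eq_intros)
  have "(\<integral>\<^sup>+z. ennreal ((if h \<le> z \<and> z \<le> s then 2 * z / R\<^sup>2 else 0) * indicator {..a} z) \<partial>lborel) =
    (\<integral>\<^sup>+z. ennreal (2 * z / R\<^sup>2) * indicator {h..min a s} z \<partial>lborel)"
    by (intro nn_integral_cong) (auto simp: indicator_def)
  \<comment> \<open>The fundamental theorem for nonnegative integrals needs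
    \<open>h \<le> min a s\<close> and a nonnegative integrand; the latter follows from
    \<open>0 < h\<close>.\<close>
  also have "\<dots> = (min a s)\<^sup>2 / R\<^sup>2 - h\<^sup>2 / R\<^sup>2"
    using assms False
    by (intro nn_integral_FTC_Icc)
       (auto intro!: deriv simp: has_real_derivative_iff_has_vector_derivative[symmetric])
  finally show ?thesis using False by (simp add: diff_divide_distrib)
qed

theorem lemma2:
  fixes P :: "(real^3) set" and c n B :: "real^3" and R\<^sub>2 h :: real
    and M :: "'a measure" and X :: "'a \<Rightarrow> real^3"
  assumes plane: "affine P" "aff_dim P = 2"
    and center: "c \<in> P" and radius: "R\<^sub>2 > 0"
    and normal: "norm n = 1" "\<forall>x\<in>P. \<forall>y\<in>P. n \<bullet> (x - y) = 0"
    and station: "h > 0" "B = c + h *\<^sub>R n"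
    and prob: "prob_space M"
    and device: "X \<in> borel_measurable M"
      "distr M borel X = uniform_measure (plane_area P) (P \<inter> cball c R\<^sub>2)"
  shows "distributed M lborel (\<lambda>\<omega>. dist B (X \<omega>))
    (\<lambda>z. ennreal (if h \<le> z \<and> z \<le> sqrt (R\<^sub>2\<^sup>2 + h\<^sup>2) then 2 * z / R\<^sub>2\<^sup>2 else 0))"
proof -
  interpret prob_space M by (rule prob)
  have [measurable]: "X \<in> borel_measurable M" by (rule device(1))
  let ?s = "sqrt (R\<^sub>2\<^sup>2 + h\<^sup>2)"
  let ?D = "P \<inter> cball c R\<^sub>2"
  \<comment> \<open>The case split matters: for \<open>a < - h\<close> the quotient would be
    positive. From \<open>?s\<close> on the value is 1, since
    \<open>?s\<^sup>2 - h\<^sup>2 = R\<^sub>2\<^sup>2\<close>.\<close>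
  let ?g = "\<lambda>a. if a < h then 0 else ((min a ?s)\<^sup>2 - h\<^sup>2) / R\<^sub>2\<^sup>2"
  have s: "h \<le> ?s" by (auto intro: real_le_rsqrt)
  have sets_D: "?D \<in> sets (plane_area P)"
    using affine_closed[OF plane(1)] by (auto simp: plane_area_def)
  have cdf: "emeasure M {\<omega> \<in> space M. dist B (X \<omega>) \<le> a} = ennreal (?g a)" for a
  proof -
    let ?A = "{x. dist B x \<le> a}"
    have A: "?A \<in> sets borel" by measurable
    have "emeasure M {\<omega> \<in> space M. dist B (X \<omega>) \<le> a} = emeasure (distr M borel X) ?A"
      using A by (auto simp: emeasure_distr intro!: arg_cong2[where f = emeasure])
    also have "\<dots> = emeasure (plane_area P) (?D \<inter> ?A) / emeasure (plane_area P) ?D"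
      using A sets_D by (subst device(2), intro emeasure_uniform_measure) (auto simp: plane_area_def)
    also have "\<dots> = emeasure (plane_area P) (?D \<inter> ?A) / ennreal (pi * R\<^sub>2\<^sup>2)"
      using emeasure_plane_area_disk[OF plane center, of R\<^sub>2] radius by simp
    also have "\<dots> = ennreal (?g a)"
    proof (cases "a < h")
      case True
      \<comment> \<open>No point of the plane is closer to \<open>B\<close> than the foot
        \<open>c\<close>, so the event is empty for \<open>a < h\<close>.\<close>
      have "h \<le> dist B x" if "x \<in> P" for x
        using dist_above_plane[OF normal(1), of x c h] normal(2) center that station
        by (auto intro: real_le_rsqrt)
      then have "?D \<inter> ?A = {}" using True by force
      with True show ?thesis by simp
    next
      case False
      \<comment> \<open>Nonnegativity lets the quotient of extended areas become a real quotient, in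
        which \<open>pi\<close> cancels.\<close>
      then have "0 \<le> (min a ?s)\<^sup>2 - h\<^sup>2"
        using s station(1) by (auto simp: abs_le_square_iff[symmetric] min_def)
      then show ?thesis
        using emeasure_plane_area_dist_above[OF plane center normal radius station(1), of a]
          False radius station(2) by (simp add: divide_ennreal)
    qed
    finally show ?thesis .
  qed
  show ?thesis
  \<comment> \<open>A law on the reals is determined by its values on the half-lines
    \<open>{..a}\<close>, so it suffices that \<open>cdf\<close> and the integrated density agree
    there.\<close>
  proof (rule distributedI_borel_atMost)
    show "AE z in lborel. 0 \<le> (if h \<le> z \<and> z \<le> ?s then 2 * z / R\<^sub>2\<^sup>2 else 0)"
      using station(1) by simp
    show "emeasure M {\<omega> \<in> space M. dist B (X \<omega>) \<le> a} = ennreal (?g a)" for a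
      by (rule cdf)
    show "(\<integral>\<^sup>+z. ennreal ((if h \<le> z \<and> z \<le> ?s then 2 * z / R\<^sub>2\<^sup>2 else 0) *
        indicator {..a} z) \<partial>lborel) = ennreal (?g a)" for a
      by (rule nn_integral_linear_density[OF station(1) s])
  qed measurable
qed

end
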